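(* Let $\mathfrak{P}_{\mathrm{sg}}=\mathfrak{P}_{\mathrm{sg}}(M,\sigma,\bar K)$ with $M,\sigma,\bar K>0$ fixed. Consider minimax regret-optimal algorithms, i.e. bandit algorithms whose worst-case regret over $\mathfrak{P}_{\mathrm{sg}}$ satisfies $\mathcal R_T\le c_0\sqrt T$ for some $c_0>0$. Fix any $c_1>0$. Then there exists a constant $c_2>0$ that depends only on $c_0,c_1$ such that, for $T$ sufficiently large, $$S_T(\Delta)\ \ge\ c_2\,T\qquad\text{for any }\Delta\in\left[0,\tfrac{c_1}{\sqrt T}\right],$$ where $S_T(\Delta)$ is the allocation variability of the algorithm on the two-armed Gaussian instance $\nu(\Delta)=\{\mathcal N(0,1),\mathcal N(-\Delta,1)\}$.
   Context: Stochastic multi-armed bandit. There are $K$ arms; for each arm $i\in[K]=\{1,\dots,K\}$, $(X^i_s)_{s\ge1}$ is an i.i.d. reward sequence with law $\nu_i$, independent across arms; $\nu=(\nu_1,\dots,\nu_K)$ is the (unknown) bandit instance. For a horizon $T$, an algorithm selects at each time $t\in[T]$ an arm $A_t\sim\pi_t(\cdot\mid\mathcal H_{t-1})$, where $\mathcal H_{t-1}=(A_1,r_1,\dots,A_{t-1},r_{t-1})$ is the observed history, $\pi_t(\cdot\mid \mathcal H_{t-1})$ is a distribution on $[K]$, $N_{i,t}=\sum_{s=1}^t\mathbf 1\{A_s=i\}$, and $r_t=X^{A_t}_{N_{A_t,t}}$. Let $\mu_i$ be the mean of $\nu_i$, $\Delta_i=\max_j\mu_j-\mu_i$. Regret: $R_T(\nu)=\sum_{i=1}^K\Delta_i\,\mathbb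 E[N_{i,T}]$. Allocation variability: $S_T(\nu)=\max_{i\in[K]}\sqrt{\operatorname{Var}(N_{i,T})}$. $\mathfrak{P}_{\mathrm{sg}}(M,\sigma,\bar K)$ is the class of instances $\nu=(\nu_1,\dots,\nu_K)$ with $2\le K\le\bar K$ such that each $\nu_i$ has mean $\mu_i\in[-M,M]$ and is $\sigma$-sub-Gaussian. $\mathcal R_T=\sup_{\nu\in\mathfrak{P}_{\mathrm{sg}}}R_T(\nu)$. Standing assumptions on algorithms: (i) if $\nu_i=\nu_j$ for some $i\ne j$ then $\mathbb E[N_{i,T}]=\mathbb E[N_{j,T}]$; (ii) for $T\ge K$, $\mathbb E[N_{i,T}]\ge1$ for each arm $i$.
   Formalization: The formal theorem assumes σ ≥ 1 and K̄ ≥ 2 instead of merely σ, K̄ > 0, so that the unit-variance Gaussian instances lie in the class; for σ < 1 a variance-testing algorithm, and for K̄ < 2 the empty class, make the claim false. *)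

theory Defs
  imports "HOL-Probability.Probability"
begin

text \<open>
  A bandit instance is the list of its reward laws. Its length is the number of arms \<open>K\<close>, and
  the arms are numbered \<open>0, \<dots>, K - 1\<close>. A history is the chronological list of pairs
  (selected arm, observed reward). A policy maps the history of length \<open>t - 1\<close> to the distribution
  of the arm selected at time \<open>t\<close>. The choice of policy may depend on the number of arms.
\<close>

type_synonym bandit = "real measure list"
type_synonym history = "(nat \<times> real) list"
type_synonym policy = "history \<Rightarrow> nat pmf"
type_synonym algorithm = "nat \<Rightarrow> policy"

text \<open>
  Histories carry the product of the discrete structure on arms and the Borel structure on
  rewards. As the set of arm sequences is discrete, measurability of the kernel is measurability in
  the rewards for every fixed arm sequence.
\<close>

definition valid_policy :: "nat \<Rightarrow> nat \<Rightarrow> policy \<Rightarrow> bool" where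
  "valid_policy K T \<pi> \<longleftrightarrow>
     (\<forall>h. length h < T \<and> fst ` set h \<subseteq> {..<K} \<longrightarrow> set_pmf (\<pi> h) \<subseteq> {..<K}) \<and>
     (\<forall>as a. length as < T \<and> set as \<subseteq> {..<K} \<longrightarrow>
        (\<lambda>r. pmf (\<pi> (zip as (map r [0..<length as]))) a)
          \<in> borel_measurable (Pi\<^sub>M {..<length as} (\<lambda>_. borel)))"

text \<open>The entry \<open>(i, s)\<close> of the reward table is the reward of pull number \<open>s + 1\<close> of arm \<open>i\<close>.\<close>

definition reward_table :: "bandit \<Rightarrow> (nat \<times> nat \<Rightarrow> real) measure" where
  "reward_table \<nu> = Pi\<^sub>M ({..<length \<nu>} \<times> UNIV) (\<lambda>(i, s). \<nu> ! i)"

text \<open>The law of the history after \<open>t\<close> rounds, conditionally on the reward table \<open>X\<close>.\<close>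

primrec play :: "policy \<Rightarrow> (nat \<times> nat \<Rightarrow> real) \<Rightarrow> nat \<Rightarrow> history pmf" where
  "play \<pi> X 0 = return_pmf []"
| "play \<pi> X (Suc t) =
     bind_pmf (play \<pi> X t)
       (\<lambda>h. map_pmf (\<lambda>a. h @ [(a, X (a, count_list (map fst h) a))]) (\<pi> h))"

definition action_law :: "policy \<Rightarrow> bandit \<Rightarrow> nat \<Rightarrow> nat list measure" where
  "action_law \<pi> \<nu> T =
     reward_table \<nu> \<bind> (\<lambda>X. measure_pmf (map_pmf (map fst) (play \<pi> X T)))"

definition num_pulls :: "nat \<Rightarrow> nat list \<Rightarrow> real" where
  "num_pulls i as = real (count_list as i)"

definition expected_pulls :: "policy \<Rightarrow> bandit \<Rightarrow> nat \<Rightarrow> nat \<Rightarrow> real" where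
  "expected_pulls \<pi> \<nu> T i = prob_space.expectation (action_law \<pi> \<nu> T) (num_pulls i)"

definition arm_mean :: "real measure \<Rightarrow> real" where
  "arm_mean P = prob_space.expectation P (\<lambda>x. x)"

definition gap :: "bandit \<Rightarrow> nat \<Rightarrow> real" where
  "gap \<nu> i = Max ((\<lambda>j. arm_mean (\<nu> ! j)) ` {..<length \<nu>}) - arm_mean (\<nu> ! i)"

definition regret :: "policy \<Rightarrow> bandit \<Rightarrow> nat \<Rightarrow> real" where
  "regret \<pi> \<nu> T = (\<Sum>i<length \<nu>. gap \<nu> i * expected_pulls \<pi> \<nu> T i)"

definition alloc_variability :: "policy \<Rightarrow> bandit \<Rightarrow> nat \<Rightarrow> real" where
  "alloc_variability \<pi> \<nu> T =
     Max ((\<lambda>i. sqrt (prob_space.variance (action_law \<pi> \<nu> T) (num_pulls i))) ` {..<length \<nu>})"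

definition subgaussian :: "real \<Rightarrow> real measure \<Rightarrow> bool" where
  "subgaussian \<sigma> P \<longleftrightarrow>
     (\<forall>l. integrable P (\<lambda>x. exp (l * (x - arm_mean P))) \<and>
          prob_space.expectation P (\<lambda>x. exp (l * (x - arm_mean P))) \<le> exp (l\<^sup>2 * \<sigma>\<^sup>2 / 2))"

definition subgaussian_class :: "real \<Rightarrow> real \<Rightarrow> nat \<Rightarrow> bandit set" where
  "subgaussian_class M \<sigma> Kbar =
     {\<nu>. 2 \<le> length \<nu> \<and> length \<nu> \<le> Kbar \<and>
         (\<forall>P\<in>set \<nu>. prob_space P \<and> sets P = sets borel \<and> integrable P (\<lambda>x. x) \<and>
                    arm_mean P \<in> {-M..M} \<and> subgaussian \<sigma> P)}"

definition worst_case_regret :: "real \<Rightarrow> real \<Rightarrow> nat \<Rightarrow> algorithm \<Rightarrow> nat \<Rightarrow> ereal" where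
  "worst_case_regret M \<sigma> Kbar alg T =
     (SUP \<nu>\<in>subgaussian_class M \<sigma> Kbar. ereal (regret (alg (length \<nu>)) \<nu> T))"

text \<open>
  Besides being well formed, an algorithm with horizon \<open>T\<close> has to pull arms with identical laws
  equally often on average, and every arm at least once on average if \<open>T\<close> permits it.
\<close>

definition bandit_algorithm :: "real \<Rightarrow> real \<Rightarrow> nat \<Rightarrow> algorithm \<Rightarrow> nat \<Rightarrow> bool" where
  "bandit_algorithm M \<sigma> Kbar alg T \<longleftrightarrow>
     (\<forall>K\<in>{2..Kbar}. valid_policy K T (alg K)) \<and>
     (\<forall>\<nu>\<in>subgaussian_class M \<sigma> Kbar. \<forall>i<length \<nu>. \<forall>j<length \<nu>.
        i \<noteq> j \<and> \<nu> ! i = \<nu> ! j \<longrightarrow>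
          expected_pulls (alg (length \<nu>)) \<nu> T i = expected_pulls (alg (length \<nu>)) \<nu> T j) \<and>
     (\<forall>\<nu>\<in>subgaussian_class M \<sigma> Kbar. length \<nu> \<le> T \<longrightarrow>
        (\<forall>i<length \<nu>. 1 \<le> expected_pulls (alg (length \<nu>)) \<nu> T i))"

definition gaussian_bandit :: "real \<Rightarrow> bandit" where
  "gaussian_bandit \<Delta> =
     [density lborel (normal_density 0 1), density lborel (normal_density (-\<Delta>) 1)]"

end

theory Submission
  imports Defs
begin

text \<open>
  On the instances \<open>\<nu>(\<plusminus>8c\<^sub>0/\<surd>T)\<close> the regret bound forces the worse arm to be pulled fewer than
  \<open>T/4\<close> times with probability at least \<open>1/2\<close>. The means of these instances differ from those of
  \<open>\<nu>(\<Delta>)\<close> by \<open>O(1/\<surd>T)\<close> in one arm only, so the likelihood ratio \<open>L\<close> of the first \<open>T\<close> rewards of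
  each arm has second moment at most \<open>exp ((8c\<^sub>0 + c\<^sub>1)\<^sup>2)\<close>. Hence under \<open>\<nu>(\<Delta>)\<close> each of the two arms
  is pulled fewer than \<open>T/4\<close> times with probability bounded away from \<open>0\<close>; as the counts add up to
  \<open>T\<close>, both tails of \<open>N\<^sub>1\<close> at distance \<open>T/4\<close> from \<open>T/2\<close> have constant mass.
\<close>

section \<open>Gaussian densities and change of measure between product laws\<close>

abbreviation gauss :: "real \<Rightarrow> real measure" where
  "gauss m \<equiv> density lborel (normal_density m 1)"

lemma prob_space_gauss: "prob_space (gauss m)"
  by (rule prob_space_normal_density) simp

text \<open>Completing the square in the exponent. Both the moment generating function and the
  likelihood ratio of two shifted Gaussians are read off from this identity.\<close>

lemma normal_density_tilt:
  "normal_density m 1 x * exp (l * (x - m)) = exp (l\<^sup>2 / 2) * normal_density (m + l) 1 x"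
proof -
  have "exp (- (x - m)\<^sup>2 / 2) * exp (l * (x - m)) = exp (l\<^sup>2 / 2) * exp (- (x - (m + l))\<^sup>2 / 2)"
    unfolding exp_add [symmetric] by (rule arg_cong [where f = exp]) (simp add: field_simps power2_eq_square)
  then show ?thesis
    by (simp add: normal_density_def)
qed

lemma gauss_mgf:
  shows "integrable (gauss m) (\<lambda>x. exp (l * (x - m)))"
    and "(\<integral>x. exp (l * (x - m)) \<partial>gauss m) = exp (l\<^sup>2 / 2)"
  by (simp_all add: integrable_density integral_density normal_density_tilt)

lemma gauss_mean:
  shows "integrable (gauss m) (\<lambda>x. x)" and "(\<integral>x. x \<partial>gauss m) = m"
  using integrable_normal_moment_nz_1 [of 1 m] integral_normal_moment_nz_1 [of 1 m]
  by (simp_all add: integrable_density integral_density)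

lemma gauss_density:
  "gauss b = density (gauss a) (\<lambda>x. ennreal (exp ((b - a) * (x - a) - (b - a)\<^sup>2 / 2)))"
proof -
  have "normal_density b 1 x = normal_density a 1 x * exp ((b - a) * (x - a) - (b - a)\<^sup>2 / 2)" for x
    using normal_density_tilt [of a x "b - a"]
    by (simp add: exp_diff)
  then show ?thesis
    by (simp add: density_density_eq flip: ennreal_mult)
qed

text \<open>The density is a product over coordinates, so its integral over a box factorises, and a
  finite product measure is determined by its values on boxes.\<close>

lemma PiM_gauss_density:
  fixes a b :: "'i \<Rightarrow> real"
  assumes "finite J"
  shows "PiM J (\<lambda>j. gauss (b j)) = density (PiM J (\<lambda>j. gauss (a j)))
           (\<lambda>X. ennreal (\<Prod>j\<in>J. exp ((b j - a j) * (X j - a j) - (b j - a j)\<^sup>2 / 2)))"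
    (is "_ = density ?P (\<lambda>X. ennreal (\<Prod>j\<in>J. ?l j (X j)))")
proof -
  interpret A: product_prob_space "\<lambda>j. gauss (a j)" J
    by (simp add: prob_space_gauss product_prob_spaceI)
  interpret B: product_prob_space "\<lambda>j. gauss (b j)" J
    by (simp add: prob_space_gauss product_prob_spaceI)
  show ?thesis
  proof (rule B.PiM_eqI [OF assms, symmetric])
    show "sets (density ?P (\<lambda>X. ennreal (\<Prod>j\<in>J. ?l j (X j)))) = sets (PiM J (\<lambda>j. gauss (b j)))"
      by (simp cong: sets_PiM_cong)
    fix E :: "'i \<Rightarrow> real set" assume E: "\<And>j. j \<in> J \<Longrightarrow> E j \<in> sets (gauss (b j))"
    then have PE: "Pi\<^sub>E J E \<in> sets ?P"
      using assms by (intro sets_PiM_I_finite) auto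
    have "emeasure (density ?P (\<lambda>X. ennreal (\<Prod>j\<in>J. ?l j (X j)))) (Pi\<^sub>E J E) =
        (\<integral>\<^sup>+X. ennreal (\<Prod>j\<in>J. ?l j (X j)) * indicator (Pi\<^sub>E J E) X \<partial>?P)"
      using PE by (subst emeasure_density) auto
    also have "\<dots> = (\<integral>\<^sup>+X. (\<Prod>j\<in>J. ennreal (?l j (X j)) * indicator (E j) (X j)) \<partial>?P)"
    proof (rule nn_integral_cong)
      fix X assume "X \<in> space ?P"
      \<comment> \<open>Membership in \<open>Pi\<^sub>E J E\<close> includes extensionality, so the
        indicator factorises only for points of the product space.\<close>
      then have "X \<in> extensional J" by (auto simp: space_PiM PiE_def)
      then have "indicator (Pi\<^sub>E J E) X = (\<Prod>j\<in>J. indicator (E j) (X j) :: ennreal)"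
        using assms by (auto simp: indicator_def PiE_iff prod_zero_iff)
      then show "ennreal (\<Prod>j\<in>J. ?l j (X j)) * indicator (Pi\<^sub>E J E) X =
          (\<Prod>j\<in>J. ennreal (?l j (X j)) * indicator (E j) (X j))"
        by (simp add: prod.distrib prod_ennreal)
    qed
    also have "\<dots> = (\<Prod>j\<in>J. \<integral>\<^sup>+x. ennreal (?l j x) * indicator (E j) x \<partial>gauss (a j))"
      using E assms by (intro A.product_nn_integral_prod) auto
    also have "\<dots> = (\<Prod>j\<in>J. emeasure (gauss (b j)) (E j))"
    proof (rule prod.cong [OF refl])
      fix j assume "j \<in> J"
      then show "(\<integral>\<^sup>+x. ennreal (?l j x) * indicator (E j) x \<partial>gauss (a j)) = emeasure (gauss (b j)) (E j)"
        using E [of j] by (subst gauss_density [of "b j" "a j"], subst emeasure_density) auto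
    qed
    finally show "emeasure (density ?P (\<lambda>X. ennreal (\<Prod>j\<in>J. ?l j (X j)))) (Pi\<^sub>E J E) =
      (\<Prod>j\<in>J. emeasure (gauss (b j)) (E j))" .
  qed
qed

text \<open>With \<open>L\<close> the likelihood ratio and \<open>B\<close> its second moment, 1/2
  \<le> E[L F] \<le> sqrt (B * E[F^2]) \<le> sqrt (B * E[F]), hence E[F] \<ge> 1/(4B). A function
  with values in [0,1] replaces an event because policies are randomised: \<open>F\<close> will be
  the probability of an event given the rewards.\<close>

lemma PiM_gauss_transfer:
  fixes a b :: "'i \<Rightarrow> real" and F :: "('i \<Rightarrow> real) \<Rightarrow> real"
  assumes J: "finite J" and F: "F \<in> borel_measurable (PiM J (\<lambda>_. borel))"
    and F01: "\<And>X. 0 \<le> F X" "\<And>X. F X \<le> 1"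
    and half: "1/2 \<le> (\<integral>X. F X \<partial>PiM J (\<lambda>j. gauss (b j)))"
  shows "exp (- (\<Sum>j\<in>J. (b j - a j)\<^sup>2)) / 4 \<le> (\<integral>X. F X \<partial>PiM J (\<lambda>j. gauss (a j)))"
proof -
  interpret A: product_prob_space "\<lambda>j. gauss (a j)" J
    by (simp add: prob_space_gauss product_prob_spaceI)
  let ?P = "PiM J (\<lambda>j. gauss (a j))"
  let ?l = "\<lambda>j x. exp ((b j - a j) * (x - a j) - (b j - a j)\<^sup>2 / 2)"
  define L where "L X = (\<Prod>j\<in>J. ?l j (X j))" for X
  define B where "B = exp (\<Sum>j\<in>J. (b j - a j)\<^sup>2)"
  have "B > 0" by (simp add: B_def)
  have sets_P: "sets ?P = sets (PiM J (\<lambda>_. borel))"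
    by (rule sets_PiM_cong) auto
  have [measurable]: "F \<in> borel_measurable ?P"
    using F by (simp add: measurable_cong_sets [OF sets_P refl])
  have [measurable]: "L \<in> borel_measurable ?P"
    unfolding L_def by measurable
  \<comment> \<open>The squared factor is again an exponential tilt, now with twice the rate, so its
    mean follows from the moment generating function: exp (-h^2) * exp (2 h^2) = exp (h^2) for h =
    \<open>b j - a j\<close>.\<close>
  have l2: "(?l j x)\<^sup>2 = exp (- (b j - a j)\<^sup>2) * exp ((2 * (b j - a j)) * (x - a j))" for j x
    by (simp flip: exp_add exp_double add: algebra_simps)
  have L2: "(L X)\<^sup>2 = (\<Prod>j\<in>J. (?l j (X j))\<^sup>2)" for X
    unfolding L_def prod_power_distrib ..
  have int_l2: "integrable (gauss (a j)) (\<lambda>x. (?l j x)\<^sup>2)" for j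
    unfolding l2 using gauss_mgf(1) by (intro integrable_mult_right)
  have "(\<integral>x. (?l j x)\<^sup>2 \<partial>gauss (a j)) = exp ((b j - a j)\<^sup>2)" for j
    unfolding l2 by (simp only: integral_mult_right_zero gauss_mgf(2))
      (simp flip: exp_add add: power2_eq_square field_simps)
  then have EL2: "(\<integral>X. (L X)\<^sup>2 \<partial>?P) = B"
    unfolding L2 B_def exp_sum [OF J] by (subst A.product_integral_prod [OF J int_l2]) simp
  have int_L2: "integrable ?P (\<lambda>X. (L X)\<^sup>2)"
    unfolding L2 using J int_l2 by (rule A.product_integrable_prod)
  have int_F: "integrable ?P F"
    by (rule A.P.integrable_const_bound [where B = 1]) (auto simp: F01)
  have "1/2 \<le> (\<integral>X. L X * F X \<partial>?P)"
    using half unfolding PiM_gauss_density [OF J, of b a]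
    by (subst (asm) integral_density) (auto simp: L_def prod_nonneg)
  also have "\<dots> \<le> (\<integral>X. B * F X + (L X)\<^sup>2 / (4 * B) \<partial>?P)"
  \<comment> \<open>The rule asks for an integrable nonnegative majorant, and both summands of the
    bound qualify.\<close>
  proof (rule integral_mono_AE')
    show "integrable ?P (\<lambda>X. B * F X + (L X)\<^sup>2 / (4 * B))"
      using int_F int_L2 by auto
    \<comment> \<open>AM-GM, which stands in for Cauchy-Schwarz on \<open>L F\<close>\<close>
    have "L X * F X \<le> B * F X + (L X)\<^sup>2 / (4 * B)" for X
    proof -
      have "0 \<le> (2 * B * F X - L X)\<^sup>2" by simp
      then have "4 * B * (L X * F X) \<le> 4 * B * (B * (F X)\<^sup>2) + (L X)\<^sup>2"
        by (simp add: power2_eq_square algebra_simps)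
      also have "(F X)\<^sup>2 \<le> F X"
        using F01 [of X] by (simp add: power2_eq_square mult_left_le)
      finally show ?thesis
        using \<open>B > 0\<close> by (simp add: field_simps)
    qed
    then show "AE X in ?P. L X * F X \<le> B * F X + (L X)\<^sup>2 / (4 * B)" by simp
    show "AE X in ?P. 0 \<le> B * F X + (L X)\<^sup>2 / (4 * B)"
      using F01 \<open>B > 0\<close> by simp
  qed
  also have "\<dots> = B * (\<integral>X. F X \<partial>?P) + 1/4"
    using int_F int_L2 EL2 \<open>B > 0\<close> by simp
  finally have "1/4 \<le> B * (\<integral>X. F X \<partial>?P)" by simp
  then have "1 / (4 * B) \<le> (\<integral>X. F X \<partial>?P)"
    using \<open>B > 0\<close> by (simp add: field_simps)
  then show ?thesis
    by (simp add: B_def exp_minus field_simps)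
qed

section \<open>Action sequences for a fixed reward table\<close>

text \<open>Once the reward table is fixed, the history is a deterministic function of the actions;
  all remaining randomness sits in the action list.\<close>

definition reward_history :: "(nat \<times> nat \<Rightarrow> real) \<Rightarrow> nat list \<Rightarrow> history" where
  "reward_history X as =
     zip as (map (\<lambda>s. X (as ! s, count_list (take s as) (as ! s))) [0..<length as])"

lemma length_reward_history [simp]: "length (reward_history X as) = length as"
  by (simp add: reward_history_def)

lemma map_fst_reward_history [simp]: "map fst (reward_history X as) = as"
  by (simp add: reward_history_def)

lemma reward_history_Nil [simp]: "reward_history X [] = []"
  by (simp add: reward_history_def)

lemma reward_history_snoc [simp]:
  "reward_history X (as @ [a]) = reward_history X as @ [(a, X (a, count_list as a))]"
  by (auto simp: reward_history_def nth_append intro!: arg_cong [where f = "zip as"])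

text \<open>The marginal of \<open>play\<close> on actions, generated directly. Its values range
  over a countable type, so dependence on \<open>X\<close> can be studied list by list.\<close>

primrec actions :: "policy \<Rightarrow> (nat \<times> nat \<Rightarrow> real) \<Rightarrow> nat \<Rightarrow> nat list pmf" where
  "actions \<pi> X 0 = return_pmf []"
| "actions \<pi> X (Suc t) =
     bind_pmf (actions \<pi> X t) (\<lambda>as. map_pmf (\<lambda>a. as @ [a]) (\<pi> (reward_history X as)))"

lemma play_eq_actions: "play \<pi> X t = map_pmf (reward_history X) (actions \<pi> X t)"
  by (induction t) (simp_all add: map_bind_pmf bind_map_pmf pmf.map_comp o_def)

lemma map_fst_play: "map_pmf (map fst) (play \<pi> X t) = actions \<pi> X t"
  by (simp add: play_eq_actions pmf.map_comp o_def pmf.map_ident)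

lemma pmf_actions_Suc:
  "pmf (actions \<pi> X (Suc t)) (as @ [a]) = pmf (actions \<pi> X t) as * pmf (\<pi> (reward_history X as)) a"
proof -
  \<comment> \<open>The law at time \<open>Suc t\<close> is a mixture over prefixes
    \<open>as'\<close>, and only the component of the prefix \<open>as\<close> can charge
    \<open>as @ [a]\<close>.\<close>
  have "pmf (map_pmf (\<lambda>a. as' @ [a]) (\<pi> (reward_history X as'))) (as @ [a]) =
      pmf (\<pi> (reward_history X as)) a * indicator {as} as'" for as'
  proof (cases "as' = as")
    case True
    have "inj (\<lambda>a. as @ [a])" by (simp add: inj_on_def)
    from pmf_map_inj' [OF this] show ?thesis using True by simp
  next
    case False
    then show ?thesis by (auto simp: pmf_eq_0_set_pmf)
  qed
  then show ?thesis
    by (simp add: pmf_bind measure_pmf_single)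
qed

abbreviation pull_lists :: "nat \<Rightarrow> nat \<Rightarrow> nat list set" where
  "pull_lists K t \<equiv> {as. set as \<subseteq> {..<K} \<and> length as = t}"

lemma set_pmf_actions:
  assumes "valid_policy K T \<pi>" and "t \<le> T"
  shows "set_pmf (actions \<pi> X t) \<subseteq> pull_lists K t"
  using assms(2)
proof (induction t)
  case (Suc t)
  show ?case
  proof
    fix as assume "as \<in> set_pmf (actions \<pi> X (Suc t))"
    then obtain bs a where bs: "bs \<in> set_pmf (actions \<pi> X t)"
      and a: "a \<in> set_pmf (\<pi> (reward_history X bs))" and as: "as = bs @ [a]" by auto
    from bs Suc have bs': "set bs \<subseteq> {..<K}" "length bs = t" by auto
    moreover have "fst ` set (reward_history X bs) = set bs"
      by (metis map_fst_reward_history set_map)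
    ultimately have "set_pmf (\<pi> (reward_history X bs)) \<subseteq> {..<K}"
      using assms(1) Suc.prems by (simp add: valid_policy_def)
    with a as bs' show "as \<in> pull_lists K (Suc t)" by auto
  qed
qed simp

text \<open>At most \<open>s\<close> pulls precede round \<open>s\<close>; hence a play of fewer
  than \<open>T\<close> rounds reads only columns below \<open>T\<close> of the table.\<close>

lemma count_list_take_less:
  assumes "s < length as"
  shows "count_list (take s as) (as ! s) < length as"
  using count_le_length [of "take s as" "as ! s"] assms by simp

lemma actions_restrict:
  assumes "valid_policy K T \<pi>" and "t \<le> T" and J: "{..<K} \<times> {..<T} \<subseteq> J"
  shows "actions \<pi> (restrict X J) t = actions \<pi> X t"
  using assms(2)
proof (induction t)
  case (Suc t)
  \<comment> \<open>Agreement is claimed on the support only: there the arms are below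
    \<open>K\<close>, so every entry that is read lies in \<open>J\<close>.\<close>
  have "reward_history (restrict X J) as = reward_history X as" if "as \<in> set_pmf (actions \<pi> X t)" for as
  proof -
    have as: "set as \<subseteq> {..<K}" "length as < T"
      using that set_pmf_actions [OF assms(1), of t X] Suc.prems by auto
    then have "(as ! s, count_list (take s as) (as ! s)) \<in> J" if "s < length as" for s
      using J count_list_take_less [OF that] that nth_mem [OF that] by (blast intro: less_trans)
    then show ?thesis
      by (auto simp: reward_history_def intro!: arg_cong [where f = "zip as"])
  qed
  moreover have "actions \<pi> (restrict X J) t = actions \<pi> X t"
    using Suc.prems by (intro Suc.IH) simp
  ultimately show ?case
    unfolding actions.simps by (intro bind_pmf_cong) (simp_all only:)
qed simp

section \<open>Measurability in the reward table\<close>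

text \<open>\<open>valid_policy\<close> gives measurability in the chronological reward vector. For
  a fixed action list this vector is a selection of table coordinates, hence a measurable function
  of the table.\<close>

lemma measurable_pmf_policy:
  assumes "valid_policy K T \<pi>" and J: "{..<K} \<times> {..<T} \<subseteq> J"
    and as: "set as \<subseteq> {..<K}" "length as < T"
  shows "(\<lambda>X. pmf (\<pi> (reward_history X as)) a) \<in> borel_measurable (PiM J (\<lambda>_. borel))"
proof -
  let ?r = "\<lambda>X. \<lambda>s\<in>{..<length as}. X (as ! s, count_list (take s as) (as ! s))"
  have "(as ! s, count_list (take s as) (as ! s)) \<in> J" if "s < length as" for s
    using J count_list_take_less [OF that] that nth_mem [OF that] as by (blast intro: less_trans)
  then have "?r \<in> PiM J (\<lambda>_. borel) \<rightarrow>\<^sub>M PiM {..<length as} (\<lambda>_. borel :: real measure)"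
    by (intro measurable_restrict measurable_component_singleton) auto
  moreover have "(\<lambda>r. pmf (\<pi> (zip as (map r [0..<length as]))) a)
      \<in> borel_measurable (PiM {..<length as} (\<lambda>_. borel))"
    using assms(1) as by (simp add: valid_policy_def)
  ultimately have "(\<lambda>X. pmf (\<pi> (zip as (map (?r X) [0..<length as]))) a)
      \<in> borel_measurable (PiM J (\<lambda>_. borel))"
    by (rule measurable_compose)
  moreover have "zip as (map (?r X) [0..<length as]) = reward_history X as" for X
    by (auto simp: reward_history_def intro!: arg_cong [where f = "zip as"])
  ultimately show ?thesis by simp
qed

lemma measurable_pmf_actions:
  assumes "valid_policy K T \<pi>" and "{..<K} \<times> {..<T} \<subseteq> J"
    and "as \<in> pull_lists K t" and "t \<le> T"
  shows "(\<lambda>X. pmf (actions \<pi> X t) as) \<in> borel_measurable (PiM J (\<lambda>_. borel))"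
  using assms(3,4)
proof (induction t arbitrary: as)
  case (Suc t)
  then obtain bs a where as: "as = bs @ [a]"
    by (cases as rule: rev_cases) auto
  with Suc.prems have bs: "bs \<in> pull_lists K t" and "t < T" by auto
  then have [measurable]: "(\<lambda>X. pmf (\<pi> (reward_history X bs)) a) \<in> borel_measurable (PiM J (\<lambda>_. borel))"
    by (intro measurable_pmf_policy [OF assms(1,2)]) auto
  have [measurable]: "(\<lambda>X. pmf (actions \<pi> X t) bs) \<in> borel_measurable (PiM J (\<lambda>_. borel))"
    using Suc.IH [OF bs] \<open>t < T\<close> by simp
  show ?case
    unfolding as pmf_actions_Suc by measurable
qed simp

lemma finite_pull_lists: "finite (pull_lists K t)"
  by (rule finite_lists_length_eq) simp

text \<open>The support lies in a finite set of lists, so the probability of an arbitrary set is a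
  finite sum of functions measurable in \<open>X\<close>.\<close>

lemma measure_actions:
  assumes "valid_policy K T \<pi>" and "t \<le> T"
  shows "measure (actions \<pi> X t) A = (\<Sum>as\<in>A \<inter> pull_lists K t. pmf (actions \<pi> X t) as)"
proof -
  have "measure (actions \<pi> X t) A = measure (actions \<pi> X t) (A \<inter> pull_lists K t)"
    using set_pmf_actions [OF assms, of X]
    by (intro measure_eq_AE) (auto simp: AE_measure_pmf_iff)
  then show ?thesis
    by (simp add: measure_measure_pmf_finite finite_pull_lists)
qed

lemma measurable_measure_actions:
  assumes "valid_policy K T \<pi>" and "{..<K} \<times> {..<T} \<subseteq> J" and "t \<le> T"
  shows "(\<lambda>X. measure (actions \<pi> X t) A) \<in> borel_measurable (PiM J (\<lambda>_. borel))"
  unfolding measure_actions [OF assms(1,3)]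
  using assms by (intro borel_measurable_sum measurable_pmf_actions) auto

lemma measurable_actions:
  assumes "valid_policy K T \<pi>" and "{..<K} \<times> {..<T} \<subseteq> J" and "t \<le> T"
  shows "(\<lambda>X. measure_pmf (actions \<pi> X t)) \<in> PiM J (\<lambda>_. borel) \<rightarrow>\<^sub>M subprob_algebra (count_space UNIV)"
proof (rule measurable_subprob_algebra)
  show "(\<lambda>X. emeasure (actions \<pi> X t) A) \<in> borel_measurable (PiM J (\<lambda>_. borel))" for A
    unfolding measure_pmf.emeasure_eq_measure
    using measurable_measure_actions [OF assms] by measurable
qed (auto intro: prob_space_imp_subprob_space measure_pmf.prob_space_axioms)

section \<open>Finite marginals of the reward table and the law of the actions\<close>

lemma PiM_arms_prob:
  assumes "\<forall>P\<in>set \<nu>. prob_space P"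
  shows "prob_space (PiM ({..<length \<nu>} \<times> S) (\<lambda>(i, s). \<nu> ! i))"
  using assms by (intro prob_space_PiM) auto

lemma sets_PiM_arms:
  assumes "\<forall>P\<in>set \<nu>. sets P = sets borel"
  shows "sets (PiM ({..<length \<nu>} \<times> S) (\<lambda>(i, s). \<nu> ! i)) =
    sets (PiM ({..<length \<nu>} \<times> S) (\<lambda>_. borel))"
  using assms by (intro sets_PiM_cong) auto

lemma distr_reward_table:
  fixes \<nu> :: bandit and T :: nat
  assumes "\<forall>P\<in>set \<nu>. prob_space P"
  defines "J \<equiv> {..<length \<nu>} \<times> {..<T}"
  shows "distr (reward_table \<nu>) (PiM J (\<lambda>(i, s). \<nu> ! i)) (\<lambda>X. restrict X J) = PiM J (\<lambda>(i, s). \<nu> ! i)"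
proof -
  \<comment> \<open>\<open>product_prob_space\<close> wants a probability measure at every index,
    while \<open>\<nu> ! i\<close> is unspecified beyond the list; a point mass fills the
    gap.\<close>
  let ?N = "\<lambda>(i, s). if i < length \<nu> then \<nu> ! i else return borel (0::real)"
  let ?I = "{..<length \<nu>} \<times> (UNIV :: nat set)"
  interpret product_prob_space ?N ?I
    using assms(1) by (intro product_prob_spaceI) (auto intro!: prob_space_return)
  have "PiM ?I ?N = reward_table \<nu>"
    unfolding reward_table_def by (rule PiM_cong) auto
  moreover have "PiM J ?N = PiM J (\<lambda>(i, s). \<nu> ! i)"
    by (rule PiM_cong) (auto simp: J_def)
  moreover have "distr (PiM ?I ?N) (PiM J ?N) (\<lambda>X. restrict X J) = PiM J ?N"
    by (rule distr_PiM_restrict_finite) (auto simp: J_def)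
  ultimately show ?thesis by simp
qed

context
  fixes \<pi> :: policy and \<nu> :: bandit and T :: nat
  assumes valid: "valid_policy (length \<nu>) T \<pi>"
    and prob: "\<forall>P\<in>set \<nu>. prob_space P"
    and borel: "\<forall>P\<in>set \<nu>. sets P = sets borel"
begin

lemma action_law_eq: "action_law \<pi> \<nu> T = reward_table \<nu> \<bind> (\<lambda>X. measure_pmf (actions \<pi> X T))"
  by (simp add: action_law_def map_fst_play)

lemma prob_space_reward_table: "prob_space (reward_table \<nu>)"
  unfolding reward_table_def by (rule PiM_arms_prob [OF prob])

lemma measurable_actions_reward_table:
  "(\<lambda>X. measure_pmf (actions \<pi> X T)) \<in> reward_table \<nu> \<rightarrow>\<^sub>M subprob_algebra (count_space UNIV)"
  unfolding reward_table_def measurable_cong_sets [OF sets_PiM_arms [OF borel] refl]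
  by (rule measurable_actions [OF valid]) auto

lemma sets_action_law [simp]: "sets (action_law \<pi> \<nu> T) = UNIV"
  unfolding action_law_eq
  by (subst sets_bind [where N = "count_space UNIV"])
    (auto simp: prob_space.not_empty [OF prob_space_reward_table])

lemma space_action_law [simp]: "space (action_law \<pi> \<nu> T) = UNIV"
  using sets_eq_imp_space_eq [of "action_law \<pi> \<nu> T" "count_space UNIV"] by simp

text \<open>Every set of action lists is an event, so only the range of \<open>f\<close>
  matters.\<close>

lemma measurable_action_law [simp, measurable]: "f \<in> action_law \<pi> \<nu> T \<rightarrow>\<^sub>M N \<longleftrightarrow> f \<in> UNIV \<rightarrow> space N"
  by (auto simp: measurable_def)

lemma prob_space_action_law: "prob_space (action_law \<pi> \<nu> T)"
  unfolding action_law_eq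
  using prob_space_reward_table measurable_actions_reward_table
  by (intro prob_space.prob_space_bind) (auto simp: measure_pmf.prob_space_axioms)

lemma AE_action_law: "AE as in action_law \<pi> \<nu> T. as \<in> pull_lists (length \<nu>) T"
proof -
  have "AE as in actions \<pi> X T. as \<in> pull_lists (length \<nu>) T" for X
    using set_pmf_actions [OF valid order_refl, of X] by (auto simp: AE_measure_pmf_iff)
  then show ?thesis
    unfolding action_law_eq by (subst AE_bind [OF measurable_actions_reward_table]) simp_all
qed

text \<open>Only the first \<open>T\<close> rewards of every arm matter, which makes the change of measure finite
  dimensional.\<close>

lemma measure_action_law:
  "measure (action_law \<pi> \<nu> T) A =
     (\<integral>X. measure (actions \<pi> X T) A \<partial>PiM ({..<length \<nu>} \<times> {..<T}) (\<lambda>(i, s). \<nu> ! i))"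
proof -
  interpret R: prob_space "reward_table \<nu>" by (rule prob_space_reward_table)
  let ?J = "{..<length \<nu>} \<times> {..<T}"
  let ?PJ = "PiM ?J (\<lambda>(i, s). \<nu> ! i)"
  have "measure (action_law \<pi> \<nu> T) A = (\<integral>X. measure (actions \<pi> X T) A \<partial>reward_table \<nu>)"
    unfolding action_law_eq by (rule R.measure_bind [OF measurable_actions_reward_table]) simp
  \<comment> \<open>After this rewriting the integrand sees \<open>X\<close> through its restriction
    only, and the integral passes to the image measure, a finite product.\<close>
  also have "\<dots> = (\<integral>X. measure (actions \<pi> (restrict X ?J) T) A \<partial>reward_table \<nu>)"
    by (simp only: actions_restrict [OF valid order_refl order_refl])
  also have "\<dots> = (\<integral>X. measure (actions \<pi> X T) A \<partial>distr (reward_table \<nu>) ?PJ (\<lambda>X. restrict X ?J))"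
  proof (rule integral_distr [symmetric])
    show "(\<lambda>X. restrict X ?J) \<in> reward_table \<nu> \<rightarrow>\<^sub>M ?PJ"
      unfolding reward_table_def by (rule measurable_restrict_subset) auto
    show "(\<lambda>X. measure (actions \<pi> X T) A) \<in> borel_measurable ?PJ"
      unfolding measurable_cong_sets [OF sets_PiM_arms [OF borel] refl]
      by (rule measurable_measure_actions [OF valid]) auto
  qed
  also have "\<dots> = (\<integral>X. measure (actions \<pi> X T) A \<partial>?PJ)"
    by (simp only: distr_reward_table [OF prob])
  finally show ?thesis .
qed

lemma AE_num_pulls_bounded: "AE as in action_law \<pi> \<nu> T. norm (num_pulls i as) \<le> real T"
  using AE_action_law by eventually_elim (auto simp: num_pulls_def count_le_length)

lemma integrable_num_pulls: "integrable (action_law \<pi> \<nu> T) (num_pulls i)"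
  using AE_num_pulls_bounded
  by (intro finite_measure.integrable_const_bound [where B = "real T"])
    (auto simp: prob_space.finite_measure prob_space_action_law)

text \<open>Markov's inequality for the complementary event.\<close>

lemma measure_few_pulls:
  assumes "c > 0"
  shows "1 - expected_pulls \<pi> \<nu> T i / c \<le> measure (action_law \<pi> \<nu> T) {as. num_pulls i as < c}"
proof -
  interpret prob_space "action_law \<pi> \<nu> T" by (rule prob_space_action_law)
  have "measure (action_law \<pi> \<nu> T) {as \<in> space (action_law \<pi> \<nu> T). c \<le> num_pulls i as} \<le>
      expected_pulls \<pi> \<nu> T i / c"
    unfolding expected_pulls_def
  proof (rule integral_Markov_inequality_measure [where A = UNIV])
    show "AE as in action_law \<pi> \<nu> T. 0 \<le> num_pulls i as" by (simp add: num_pulls_def)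
  qed (simp_all add: assms integrable_num_pulls)
  moreover have "{as. num_pulls i as < c} = space (action_law \<pi> \<nu> T) - {as. c \<le> num_pulls i as}"
    by auto
  ultimately show ?thesis
    using prob_compl [of "{as. c \<le> num_pulls i as}"] by simp
qed

end

section \<open>The two-armed Gaussian instances\<close>

lemma set_gaussian_bandit:
  "\<forall>P\<in>set (gaussian_bandit d). prob_space P" "\<forall>P\<in>set (gaussian_bandit d). sets P = sets borel"
  by (auto simp: gaussian_bandit_def prob_space_gauss)

lemma length_gaussian_bandit [simp]: "length (gaussian_bandit d) = 2"
  by (simp add: gaussian_bandit_def)

lemma lessThan_2: "{..<2} = {0, Suc 0}" by auto

text \<open>The two instances differ only in the mean of arm 1, whose \<open>T\<close> relevant
  rewards contribute \<open>(d' - d)\<^sup>2\<close> each to the exponent. The function being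
  transferred is the probability of \<open>A\<close> given the rewards.\<close>

lemma gaussian_bandit_transfer:
  assumes valid: "valid_policy 2 T \<pi>"
    and "1/2 \<le> measure (action_law \<pi> (gaussian_bandit d') T) A"
  shows "exp (- (real T * (d' - d)\<^sup>2)) / 4 \<le> measure (action_law \<pi> (gaussian_bandit d) T) A"
proof -
  let ?J = "{..<2} \<times> {..<T} :: (nat \<times> nat) set"
  let ?m = "\<lambda>d j. if fst j = (0::nat) then 0 else - d :: real"
  have law: "measure (action_law \<pi> (gaussian_bandit d) T) A =
      (\<integral>X. measure (actions \<pi> X T) A \<partial>PiM ?J (\<lambda>j. gauss (?m d j)))" for d
  proof -
    have "PiM ?J (\<lambda>(i, s). gaussian_bandit d ! i) = PiM ?J (\<lambda>j. gauss (?m d j))"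
      by (rule PiM_cong) (auto simp: gaussian_bandit_def lessThan_2)
    then show ?thesis
      using measure_action_law [of "gaussian_bandit d" T \<pi> A] set_gaussian_bandit [of d] valid by simp
  qed
  have "(\<Sum>j\<in>?J. (?m d' j - ?m d j)\<^sup>2) = (\<Sum>i<2. \<Sum>s<T. (?m d' (i, s) - ?m d (i, s))\<^sup>2)"
    unfolding sum.cartesian_product by (simp add: split_def)
  also have "\<dots> = real T * (d' - d)\<^sup>2"
    by (simp add: lessThan_2 power2_commute)
  finally have *: "(\<Sum>j\<in>?J. (?m d' j - ?m d j)\<^sup>2) = real T * (d' - d)\<^sup>2" .
  have "exp (- (\<Sum>j\<in>?J. (?m d' j - ?m d j)\<^sup>2)) / 4 \<le>
      (\<integral>X. measure (actions \<pi> X T) A \<partial>PiM ?J (\<lambda>j. gauss (?m d j)))"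
    using assms(2) unfolding law
    by (intro PiM_gauss_transfer measurable_measure_actions [OF valid]) auto
  then show ?thesis
    unfolding * law .
qed

lemma arm_mean_gauss: "arm_mean (gauss m) = m"
  by (simp add: arm_mean_def gauss_mean)

text \<open>The moment generating function of a centred unit-variance Gaussian equals exp (l^2/2),
  which is within the sub-Gaussian bound once \<open>1 \<le> \<sigma>\<close>. Negative
  \<open>d\<close> is covered too; it makes arm 0 the worse arm.\<close>

lemma gaussian_bandit_in_class:
  assumes "\<bar>d\<bar> \<le> M" and "1 \<le> \<sigma>" and "2 \<le> Kbar"
  shows "gaussian_bandit d \<in> subgaussian_class M \<sigma> Kbar"
proof -
  have "subgaussian \<sigma> (gauss m)" for m
  proof -
    have "exp (l\<^sup>2 / 2) \<le> exp (l\<^sup>2 * \<sigma>\<^sup>2 / 2)" for l :: real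
      using mult_left_mono [of 1 "\<sigma>\<^sup>2" "l\<^sup>2"] assms(2) by simp
    then show ?thesis
      by (simp add: subgaussian_def arm_mean_gauss gauss_mgf)
  qed
  with assms show ?thesis
    by (auto simp: subgaussian_class_def gaussian_bandit_def prob_space_gauss gauss_mean arm_mean_gauss)
qed

lemma regret_gaussian_bandit:
  "regret \<pi> (gaussian_bandit d) T =
     max 0 (- d) * expected_pulls \<pi> (gaussian_bandit d) T 0 + max 0 d * expected_pulls \<pi> (gaussian_bandit d) T 1"
proof -
  have "arm_mean (gaussian_bandit d ! 0) = 0" "arm_mean (gaussian_bandit d ! 1) = - d"
    by (simp_all add: gaussian_bandit_def arm_mean_gauss)
  then show ?thesis
    by (simp add: regret_def gap_def lessThan_2 max_def)
qed

section \<open>From two tails to the variance\<close>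

text \<open>Wherever the mean lies relative to \<open>c\<close>, the tail on the opposite side is at
  distance at least \<open>r\<close> from it, and Chebyshev's inequality applies to that
  tail.\<close>

lemma variance_ge_two_tails:
  fixes f :: "'a \<Rightarrow> real"
  assumes "prob_space M" and f: "f \<in> borel_measurable M" and f2: "integrable M (\<lambda>x. (f x)\<^sup>2)"
    and "r > 0"
    and low: "p \<le> measure M {x\<in>space M. f x \<le> c - r}"
    and high: "p \<le> measure M {x\<in>space M. c + r \<le> f x}"
  shows "p * r\<^sup>2 \<le> prob_space.variance M f"
proof -
  interpret prob_space M by fact
  note [measurable] = f
  let ?D = "{x\<in>space M. r \<le> \<bar>f x - expectation f\<bar>}"
  have "p \<le> measure M ?D"
  proof (cases "c \<le> expectation f")
    case True
    have "measure M {x\<in>space M. f x \<le> c - r} \<le> measure M ?D"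
      using True by (intro finite_measure_mono) auto
    with low show ?thesis by simp
  next
    case False
    have "measure M {x\<in>space M. c + r \<le> f x} \<le> measure M ?D"
      using False by (intro finite_measure_mono) auto
    with high show ?thesis by simp
  qed
  also have "\<dots> \<le> variance f / r\<^sup>2"
    using f f2 \<open>r > 0\<close> by (rule Chebyshev_inequality)
  finally show ?thesis
    using \<open>r > 0\<close> by (simp add: field_simps)
qed

lemma alloc_variability_ge:
  assumes valid: "valid_policy 2 T \<pi>" and "T > 0"
    and p0: "p \<le> measure (action_law \<pi> (gaussian_bandit d) T) {as. num_pulls 0 as < real T / 4}"
    and p1: "p \<le> measure (action_law \<pi> (gaussian_bandit d) T) {as. num_pulls 1 as < real T / 4}"
  shows "sqrt p / 4 * real T \<le> alloc_variability \<pi> (gaussian_bandit d) T"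
proof -
  let ?\<nu> = "gaussian_bandit d"
  let ?P = "action_law \<pi> ?\<nu> T"
  have valid': "valid_policy (length ?\<nu>) T \<pi>" using valid by simp
  note hyps = valid' set_gaussian_bandit
  interpret prob_space ?P by (rule prob_space_action_law [OF hyps])
  note [simp] = sets_action_law [OF hyps] space_action_law [OF hyps] measurable_action_law [OF hyps]
  have f2: "integrable ?P (\<lambda>as. (num_pulls 0 as)\<^sup>2)"
    using AE_num_pulls_bounded [OF hyps, of 0]
    by (intro integrable_const_bound [where B = "(real T)\<^sup>2"]) (auto elim!: eventually_mono simp flip: abs_le_square_iff)
  \<comment> \<open>Almost surely the two counts add up to \<open>T\<close>, so fewer than T/4 pulls
    of arm 1 mean more than 3T/4 = T/2 + T/4 pulls of arm 0. This turns \<open>p1\<close> into the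
    upper tail of \<open>num_pulls 0\<close>.\<close>
  have AE_le: "AE as in ?P. as \<in> {as. num_pulls 1 as < real T / 4} \<longrightarrow> as \<in> {as. real T / 2 + real T / 4 \<le> num_pulls 0 as}"
    using AE_action_law [OF hyps]
  proof eventually_elim
    case (elim as)
    then have "set as \<subseteq> {0, 1}" "length as = T"
      by (auto simp: lessThan_2)
    with sum_count_set [of as "{0, 1}"] have "count_list as 0 + count_list as 1 = T"
      by simp
    then have "num_pulls 0 as + num_pulls 1 as = real T"
      unfolding num_pulls_def by (simp flip: of_nat_add)
    then show ?case by simp
  qed
  have "measure ?P {as. num_pulls 1 as < real T / 4} \<le> measure ?P {as. real T / 2 + real T / 4 \<le> num_pulls 0 as}"
    by (rule finite_measure_mono_AE [OF AE_le]) simp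
  then have high: "p \<le> measure ?P {as\<in>space ?P. real T / 2 + real T / 4 \<le> num_pulls 0 as}"
    using p1 by simp
  have "measure ?P {as. num_pulls 0 as < real T / 4} \<le> measure ?P {as. num_pulls 0 as \<le> real T / 2 - real T / 4}"
    by (rule finite_measure_mono) auto
  then have low: "p \<le> measure ?P {as\<in>space ?P. num_pulls 0 as \<le> real T / 2 - real T / 4}"
    using p0 by simp
  have "p * (real T / 4)\<^sup>2 \<le> variance (num_pulls 0)"
    using f2 \<open>T > 0\<close> low high
    by (intro variance_ge_two_tails [where c = "real T / 2"] prob_space_axioms) simp_all
  then have "sqrt (p * (real T / 4)\<^sup>2) \<le> sqrt (variance (num_pulls 0))"
    by (rule real_sqrt_le_mono)
  also have "\<dots> \<le> alloc_variability \<pi> ?\<nu> T"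
    unfolding alloc_variability_def by (intro Max_ge) auto
  finally show ?thesis
    by (simp add: real_sqrt_mult)
qed

text \<open>The \<open>if\<close> selects the worse arm, whose gap is \<open>\<bar>d\<bar>\<close>.
  The factor 8 makes its expected number of pulls at most T/8, and Markov's inequality at level T/4
  then leaves probability 1/2.\<close>

lemma few_pulls_of_regret_bound:
  assumes valid: "valid_policy 2 T \<pi>" and "T > 0" and "c > 0"
    and reg: "regret \<pi> (gaussian_bandit d) T \<le> c * sqrt (real T)"
    and d: "\<bar>d\<bar> = 8 * c / sqrt (real T)"
  shows "1/2 \<le> measure (action_law \<pi> (gaussian_bandit d) T)
           {as. num_pulls (if d < 0 then 0 else 1) as < real T / 4}"
proof -
  let ?i = "if d < 0 then 0 else 1 :: nat"
  let ?E = "expected_pulls \<pi> (gaussian_bandit d) T ?i"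
  have "\<bar>d\<bar> * ?E \<le> c * sqrt (real T)"
    using reg by (simp add: regret_gaussian_bandit max_def split: if_splits)
  then have "c * (8 * ?E) \<le> c * real T"
    using \<open>T > 0\<close> unfolding d by (simp add: field_simps)
  then have "8 * ?E \<le> real T"
    using \<open>c > 0\<close> by simp
  then have "?E / (real T / 4) \<le> 1/2"
    using \<open>T > 0\<close> by (simp add: field_simps)
  moreover have "1 - ?E / (real T / 4) \<le>
      measure (action_law \<pi> (gaussian_bandit d) T) {as. num_pulls ?i as < real T / 4}"
    using valid set_gaussian_bandit \<open>T > 0\<close> by (intro measure_few_pulls) simp_all
  ultimately show ?thesis by linarith
qed

theorem theorem2:
  fixes c0 c1 :: real
  assumes "c0 > 0" and "c1 > 0"
  shows "\<exists>c2>0. \<forall>(M::real) (\<sigma>::real) (Kbar::nat). M > 0 \<longrightarrow> \<sigma> \<ge> 1 \<longrightarrow> Kbar \<ge> 2 \<longrightarrow>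
           (\<exists>T0. \<forall>T\<ge>T0. \<forall>alg.
              bandit_algorithm M \<sigma> Kbar alg T \<longrightarrow>
              worst_case_regret M \<sigma> Kbar alg T \<le> ereal (c0 * sqrt (real T)) \<longrightarrow>
              (\<forall>\<Delta>\<in>{0..c1 / sqrt (real T)}.
                 alloc_variability (alg 2) (gaussian_bandit \<Delta>) T \<ge> c2 * real T))"
proof -
  \<comment> \<open>Fixed before \<open>M\<close>, \<open>\<sigma>\<close> and \<open>Kbar\<close>,
    so it depends on \<open>c0\<close> and \<open>c1\<close> alone. It is the transfer bound for two
    instances whose parameters differ by at most (8 c0 + c1)/sqrt T.\<close>
  define p where "p = exp (- (8 * c0 + c1)\<^sup>2) / 4"
  have "\<exists>T0. \<forall>T\<ge>T0. \<forall>alg.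
          bandit_algorithm M \<sigma> Kbar alg T \<longrightarrow>
          worst_case_regret M \<sigma> Kbar alg T \<le> ereal (c0 * sqrt (real T)) \<longrightarrow>
          (\<forall>\<Delta>\<in>{0..c1 / sqrt (real T)}.
             alloc_variability (alg 2) (gaussian_bandit \<Delta>) T \<ge> sqrt p / 4 * real T)"
    if M: "M > 0" and \<sigma>: "\<sigma> \<ge> 1" and Kbar: "Kbar \<ge> 2" for M \<sigma> :: real and Kbar :: nat
  proof (intro exI allI impI ballI)
    fix T :: nat and alg :: algorithm and \<Delta> :: real
    \<comment> \<open>The threshold ensures \<open>D \<le> M\<close>, which puts the instances with
      parameter \<open>D\<close> and \<open>- D\<close> into the class; the added 1 gives
      \<open>T > 0\<close>.\<close>
    assume T: "nat \<lceil>(8 * c0 / M)\<^sup>2\<rceil> + 1 \<le> T" and alg: "bandit_algorithm M \<sigma> Kbar alg T"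
      and wc: "worst_case_regret M \<sigma> Kbar alg T \<le> ereal (c0 * sqrt (real T))"
      and \<Delta>: "\<Delta> \<in> {0..c1 / sqrt (real T)}"
    define D where "D = 8 * c0 / sqrt (real T)"
    have "T > 0" using T by simp
    then have "D > 0" using \<open>c0 > 0\<close> by (simp add: D_def)
    have "(8 * c0 / M)\<^sup>2 \<le> real T" using T by linarith
    then have "8 * c0 / M \<le> sqrt (real T)" by (rule real_le_rsqrt)
    then have "D \<le> M"
      using \<open>T > 0\<close> M by (simp add: D_def field_simps)
    have valid: "valid_policy 2 T (alg 2)"
      using alg Kbar by (simp add: bandit_algorithm_def)
    have tail: "p \<le> measure (action_law (alg 2) (gaussian_bandit \<Delta>) T)
        {as. num_pulls (if d < 0 then 0 else 1) as < real T / 4}" if d: "\<bar>d\<bar> = D" for d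
    proof -
      have "gaussian_bandit d \<in> subgaussian_class M \<sigma> Kbar"
        using d \<open>D \<le> M\<close> \<sigma> Kbar by (intro gaussian_bandit_in_class) auto
      then have "ereal (regret (alg 2) (gaussian_bandit d) T) \<le> worst_case_regret M \<sigma> Kbar alg T"
        unfolding worst_case_regret_def by (rule SUP_upper2) simp
      with wc have "regret (alg 2) (gaussian_bandit d) T \<le> c0 * sqrt (real T)"
        using ereal_less_eq(3) order_trans by blast
      then have "1/2 \<le> measure (action_law (alg 2) (gaussian_bandit d) T)
          {as. num_pulls (if d < 0 then 0 else 1) as < real T / 4}"
        using valid \<open>T > 0\<close> \<open>c0 > 0\<close> d by (intro few_pulls_of_regret_bound) (auto simp: D_def)
      note gaussian_bandit_transfer [OF valid this, of \<Delta>]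
      moreover have "real T * (d - \<Delta>)\<^sup>2 \<le> (8 * c0 + c1)\<^sup>2"
      proof -
        \<comment> \<open>Triangle inequality, with
          \<open>\<bar>d\<bar> = 8 * c0 / sqrt (real T)\<close> and
          \<open>\<Delta> \<le> c1 / sqrt (real T)\<close>; the factor \<open>T\<close> in the
          exponent then cancels.\<close>
        have "\<bar>d - \<Delta>\<bar> \<le> (8 * c0 + c1) / sqrt (real T)"
          using d \<Delta> by (auto simp: D_def add_divide_distrib)
        then have "sqrt (real T) * \<bar>d - \<Delta>\<bar> \<le> 8 * c0 + c1"
          using \<open>T > 0\<close> by (simp add: field_simps)
        then have "(sqrt (real T) * \<bar>d - \<Delta>\<bar>)\<^sup>2 \<le> (8 * c0 + c1)\<^sup>2"
          by (intro power_mono) auto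
        then show ?thesis by (simp add: power_mult_distrib)
      qed
      ultimately show ?thesis
        unfolding p_def by (smt (verit) divide_right_mono exp_le_cancel_iff)
    qed
    show "sqrt p / 4 * real T \<le> alloc_variability (alg 2) (gaussian_bandit \<Delta>) T"
      \<comment> \<open>Arm 0 is the worse one for \<open>- D\<close> and arm 1 for
        \<open>D\<close>, so the two instances supply the two tails.\<close>
      using tail [of "- D"] tail [of D] \<open>D > 0\<close> \<open>T > 0\<close>
      by (intro alloc_variability_ge valid) auto
  qed
  moreover have "sqrt p / 4 > 0" by (simp add: p_def)
  ultimately show ?thesis by blast
qed

end
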